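(* Let $G/\pi$ be a quotient graph whose shift matrix $\widetilde S$ is symmetric, and let $\widetilde D=\widetilde Q^\top\widetilde S\widetilde Q$ be the corresponding discriminant. If perfect state transfer occurs from the quotient vertex-type state $x_{C_i}$ to $x_{C_j}$ at time $k$, then $$T_k(\mu)=\pm1\quad\text{for every }\mu\in\Sigma_{C_i}.$$
   Context: $G$ is a $d$-regular directed graph (all in- and out-degrees equal $d$) with an equitable vertex partition $\pi=\{C_1,\dots,C_r\}$ (every vertex of $C_i$ has the same number $b_{ij}$ of out-neighbours in $C_j$). $G/\pi$ is the directed multigraph on the cells with adjacency matrix $\widetilde A=(b_{ij})$, assumed $d$-regular, with shunt decomposition $\widetilde A=\sum_{j=1}^d\widetilde P_j$ into permutation matrices. The shift matrix is $\widetilde S=\sum_jE_{jj}\otimes\widetilde P_j$ ($E_{jj}$ the $d\times d$ diagonal matrix units), acting on $\mathbb C^{dr}$ with coordinates indexed by the arcs of $G/\pi$. $\widetilde Q\in\mathbb R^{dr\times r}$ is the normalized characteristic matrix of the partition of the arcs of $G/\pi$ by terminal vertex (each column is the indicator vector of a class divided by the square root of its size), so $\widetilde Q^\top\widetilde Q=I_r$. The evolution operator is $\widetilde U=\widetilde S(2\widetilde Q\widetilde Q^\top-I)$. With $e_{C_i}\in\mathbb C^r$ the standard basis vector, the quotient vertex-type state is $x_{C_i}=\widetilde Qe_{C_i}$. Perfect state transfer occurs from $x_{C_i}$ to $x_{C_j}$ at time $k$ (a non-negative integer) if $|\langle x_{C_j},\widetilde U^kx_{C_i}\rangle|=1$.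 The eigenvalue support is $\Sigma_{C_i}=\{\mu\in\operatorname{Spec}(\widetilde D):\widetilde E_\mu e_{C_i}\ne0\}$, where $\widetilde E_\mu$ is the orthogonal projection onto the $\mu$-eigenspace of the real symmetric matrix $\widetilde D$. $T_k$ is the Chebyshev polynomial of the first kind: $T_0(p)=1$, $T_1(p)=p$, $T_k(p)=2pT_{k-1}(p)-T_{k-2}(p)$. *)

theory Defs
  imports "HOL-Analysis.Analysis" "Graph_Theory.Digraph"
begin

section \<open>Regular digraphs and equitable partitions\<close>

definition regular_digraph :: "nat \<Rightarrow> ('v, 'e) pre_digraph \<Rightarrow> bool" where
  "regular_digraph d G \<longleftrightarrow> (\<forall>v\<in>verts G. out_degree G v = d \<and> in_degree G v = d)"

definition vertex_partition :: "('v, 'e) pre_digraph \<Rightarrow> ('r \<Rightarrow> 'v set) \<Rightarrow> bool" where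
  "vertex_partition G C \<longleftrightarrow>
     (\<Union>i. C i) = verts G \<and> disjoint_family C \<and> (\<forall>i. C i \<noteq> {})"

text \<open>Since the cells are nonempty, the numbers \<open>b i j\<close> are determined by \<open>G\<close> and \<open>C\<close>.\<close>

definition equitable_partition ::
    "('v, 'e) pre_digraph \<Rightarrow> ('r \<Rightarrow> 'v set) \<Rightarrow> ('r \<Rightarrow> 'r \<Rightarrow> nat) \<Rightarrow> bool" where
  "equitable_partition G C b \<longleftrightarrow> vertex_partition G C \<and>
     (\<forall>i j. \<forall>u\<in>C i. card {v \<in> C j. (u, v) \<in> arcs_ends G} = b i j)"

definition quotient_matrix :: "('r::finite \<Rightarrow> 'r \<Rightarrow> nat) \<Rightarrow> real^'r^'r" where
  "quotient_matrix b = (\<chi> i j. real (b i j))"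

text \<open>Row sums are out-degrees and column sums are in-degrees of the directed multigraph
  with the given adjacency matrix.\<close>

definition regular_adjacency :: "nat \<Rightarrow> real^'r^'r::finite \<Rightarrow> bool" where
  "regular_adjacency d A \<longleftrightarrow>
     (\<forall>i. (\<Sum>j\<in>UNIV. A $ i $ j) = real d) \<and> (\<forall>j. (\<Sum>i\<in>UNIV. A $ i $ j) = real d)"

section \<open>Shunt decompositions\<close>

definition permutation_matrix :: "real^'r^'r::finite \<Rightarrow> bool" where
  "permutation_matrix M \<longleftrightarrow>
     (\<exists>\<sigma>. \<sigma> permutes UNIV \<and> M = (\<chi> i j. if j = \<sigma> i then 1 else 0))"

text \<open>The index type \<open>'d\<close> of the shunts has \<open>CARD('d) = d\<close> elements.\<close>

definition shunt_decomposition :: "real^'r^'r::finite \<Rightarrow> ('d::finite \<Rightarrow> real^'r^'r) \<Rightarrow> bool" where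
  "shunt_decomposition A P \<longleftrightarrow> (\<forall>s. permutation_matrix (P s)) \<and> A = (\<Sum>s\<in>UNIV. P s)"

text \<open>The multigraph with adjacency matrix \<open>\<Sum>s. P s\<close>. In each \<open>P s\<close> every cell \<open>c\<close> is the
  terminal vertex of exactly one arc; that arc is \<open>(s, c)\<close>, and it corresponds to the
  basis vector \<open>e\<^sub>s \<otimes> e\<^sub>c\<close>. (Letting \<open>(s, c)\<close> be the arc of \<open>P s\<close> with initial vertex \<open>c\<close>
  conjugates the walk below by the shift matrix and leaves the discriminant and all inner
  products of states unchanged.)\<close>

definition shunt_digraph ::
    "('d::finite \<Rightarrow> real^'r^'r::finite) \<Rightarrow> ('r, 'd \<times> 'r) pre_digraph" where
  "shunt_digraph P = \<lparr>verts = UNIV, arcs = UNIV,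
     tail = (\<lambda>(s, c). THE u. P s $ u $ c = 1), head = (\<lambda>(s, c). c)\<rparr>"

lemma shunt_digraph_adjacency:
  assumes "shunt_decomposition A P"
  shows "real (card {e \<in> arcs (shunt_digraph P).
      tail (shunt_digraph P) e = i \<and> head (shunt_digraph P) e = j}) = A $ i $ j"
proof -
  have P: "(P s $ i $ j = (if (THE u. P s $ u $ j = 1) = i then 1 else 0))" for s
  proof -
    obtain \<sigma> where "\<sigma> permutes UNIV" and M: "P s = (\<chi> i j. if j = \<sigma> i then 1 else 0)"
      using assms unfolding shunt_decomposition_def permutation_matrix_def by metis
    then have b: "bij \<sigma>" by (simp add: permutes_bij)
    then have "(THE u. P s $ u $ j = 1) = inv \<sigma> j"
      by (intro the_equality) (auto simp: M bij_is_surj bij_is_inj surj_f_inv_f inv_f_f split: if_splits)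
    then show ?thesis using b by (auto simp: M bij_is_surj bij_is_inj surj_f_inv_f inv_f_f)
  qed
  have "{e \<in> arcs (shunt_digraph P).
      tail (shunt_digraph P) e = i \<and> head (shunt_digraph P) e = j}
      = (\<lambda>s. (s, j)) ` {s. (THE u. P s $ u $ j = 1) = i}"
    by (auto simp: shunt_digraph_def)
  then show ?thesis
    using assms by (simp add: shunt_decomposition_def P card_image inj_on_def sum.If_cases)
qed

section \<open>The quotient walk\<close>

definition kronecker :: "real^'a^'b \<Rightarrow> real^'c^'d \<Rightarrow> real^('a::finite \<times> 'c::finite)^('b::finite \<times> 'd::finite)" where
  "kronecker A B = (\<chi> p q. A $ fst p $ fst q * B $ snd p $ snd q)"

definition matrix_unit :: "'n::finite \<Rightarrow> 'n \<Rightarrow> real^'n^'n" where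
  "matrix_unit s t = (\<chi> i j. if i = s \<and> j = t then 1 else 0)"

definition shift_matrix ::
    "('d::finite \<Rightarrow> real^'r^'r::finite) \<Rightarrow> real^('d \<times> 'r)^('d \<times> 'r)" where
  "shift_matrix P = (\<Sum>s\<in>UNIV. kronecker (matrix_unit s s) (P s))"

text \<open>The partition is given by the map \<open>f\<close> sending an element to its class.\<close>

definition normalized_char_matrix :: "('a::finite \<Rightarrow> 'c::finite) \<Rightarrow> real^'c^'a" where
  "normalized_char_matrix f =
     (\<chi> a c. if f a = c then 1 / sqrt (real (card {a'. f a' = c})) else 0)"

definition terminal_matrix ::
    "('d::finite \<Rightarrow> real^'r^'r::finite) \<Rightarrow> real^'r^('d \<times> 'r)" where
  "terminal_matrix P = normalized_char_matrix (head (shunt_digraph P))"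

lemma terminal_matrix_orthonormal:
  fixes P :: "'d::finite \<Rightarrow> real^'r^'r::finite"
  shows "transpose (terminal_matrix P) ** terminal_matrix P = mat 1"
proof -
  have "{a::'d \<times> 'r. snd a = c} = (\<lambda>s. (s, c)) ` UNIV" for c by auto
  then have card: "card {a::'d \<times> 'r. snd a = c} = CARD('d)" for c
    by (simp add: card_image inj_on_def)
  have *: "(\<Sum>a::'d \<times> 'r\<in>UNIV. (if snd a = i then x else 0) * (if snd a = j then x else 0))
      = (if i = j then real CARD('d) * (x * x) else 0)" for i j and x :: real
  proof (cases "i = j")
    case True
    have "(\<Sum>a::'d \<times> 'r\<in>UNIV. (if snd a = j then x else 0) * (if snd a = j then x else 0))
        = (\<Sum>a::'d \<times> 'r\<in>UNIV. if snd a = j then x * x else 0)"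
      by (rule sum.cong) auto
    then show ?thesis using True card[of j] by (simp add: sum.If_cases)
  qed (auto intro!: sum.neutral)
  have Q: "terminal_matrix P $ a $ c = (if snd a = c then 1 / sqrt (real CARD('d)) else 0)" for a c
    by (simp add: terminal_matrix_def normalized_char_matrix_def shunt_digraph_def case_prod_beta'
        card)
  show ?thesis
    by (simp add: matrix_matrix_mult_def transpose_def mat_def vec_eq_iff Q *)
qed

definition discriminant :: "('d::finite \<Rightarrow> real^'r^'r::finite) \<Rightarrow> real^'r^'r" where
  "discriminant P = transpose (terminal_matrix P) ** shift_matrix P ** terminal_matrix P"

definition evolution ::
    "('d::finite \<Rightarrow> real^'r^'r::finite) \<Rightarrow> complex^('d \<times> 'r)^('d \<times> 'r)" where
  "evolution P = map_matrix complex_of_real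
     (shift_matrix P ** (2 *\<^sub>R (terminal_matrix P ** transpose (terminal_matrix P)) - mat 1))"

definition vertex_state ::
    "('d::finite \<Rightarrow> real^'r^'r::finite) \<Rightarrow> 'r \<Rightarrow> complex^('d \<times> 'r)" where
  "vertex_state P i = map_matrix complex_of_real (terminal_matrix P) *v axis i 1"

text \<open>The library's inner product on \<open>complex^'n\<close> is the real part of this one. Powers of
  matrices are iterated applications, as \<open>^\<close> on the vector type is componentwise.\<close>

definition hermitian_inner :: "complex^'n \<Rightarrow> complex^'n::finite \<Rightarrow> complex" where
  "hermitian_inner x y = (\<Sum>a\<in>UNIV. cnj (x $ a) * y $ a)"

definition perfect_state_transfer ::
    "('d::finite \<Rightarrow> real^'r^'r::finite) \<Rightarrow> 'r \<Rightarrow> 'r \<Rightarrow> nat \<Rightarrow> bool" where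
  "perfect_state_transfer P i j k \<longleftrightarrow>
     cmod (hermitian_inner (vertex_state P j)
       (((\<lambda>x. evolution P *v x) ^^ k) (vertex_state P i))) = 1"

section \<open>Eigenvalue supports and Chebyshev polynomials\<close>

definition eigenspace :: "real^'n^'n::finite \<Rightarrow> real \<Rightarrow> (real^'n) set" where
  "eigenspace M \<mu> = {v. M *v v = \<mu> *\<^sub>R v}"

definition spectrum :: "real^'n^'n::finite \<Rightarrow> real set" where
  "spectrum M = {\<mu>. \<exists>v. v \<noteq> 0 \<and> v \<in> eigenspace M \<mu>}"

definition orthogonal_projection :: "'a::euclidean_space set \<Rightarrow> 'a \<Rightarrow> 'a" where
  "orthogonal_projection V x = (THE y. y \<in> V \<and> (\<forall>v\<in>V. orthogonal (x - y) v))"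

lemma orthogonal_projection_works:
  assumes "subspace V"
  shows "orthogonal_projection V x \<in> V \<and> (\<forall>v\<in>V. orthogonal (x - orthogonal_projection V x) v)"
  unfolding orthogonal_projection_def
proof (rule theI')
  obtain y z where "y \<in> span V" "\<And>w. w \<in> span V \<Longrightarrow> orthogonal z w" "x = y + z"
    using orthogonal_subspace_decomp_exists[of V x] by metis
  then have "y \<in> V \<and> (\<forall>v\<in>V. orthogonal (x - y) v)"
    using assms by (auto simp: span_base dest: span_eq_iff[THEN iffD2])
  moreover have "y' = y''" if "y' \<in> V \<and> (\<forall>v\<in>V. orthogonal (x - y') v)"
    and "y'' \<in> V \<and> (\<forall>v\<in>V. orthogonal (x - y'') v)" for y' y''
  proof -
    have "y' - y'' \<in> V" using that assms by (auto intro: subspace_diff)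
    then have "(x - y'') \<bullet> (y' - y'') - (x - y') \<bullet> (y' - y'') = 0"
      using that by (simp add: orthogonal_def)
    then have "(y' - y'') \<bullet> (y' - y'') = 0" by (simp add: inner_diff_left)
    then show ?thesis by simp
  qed
  ultimately show "\<exists>!y. y \<in> V \<and> (\<forall>v\<in>V. orthogonal (x - y) v)" by blast
qed

text \<open>For a symmetric real matrix all eigenvalues are real and the projections are real
  matrices, so nothing is lost by working over the reals here.\<close>

definition eigenvalue_support :: "real^'n^'n::finite \<Rightarrow> 'n \<Rightarrow> real set" where
  "eigenvalue_support M i =
     {\<mu> \<in> spectrum M. orthogonal_projection (eigenspace M \<mu>) (axis i 1) \<noteq> 0}"

fun chebyshev_T :: "nat \<Rightarrow> real \<Rightarrow> real" where
  "chebyshev_T 0 p = 1"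
| "chebyshev_T (Suc 0) p = p"
| "chebyshev_T (Suc (Suc k)) p = 2 * p * chebyshev_T (Suc k) p - chebyshev_T k p"

end

theory Submission
  imports Defs
begin

text \<open>Since \<open>S\<close> is a symmetric permutation matrix, both \<open>S\<close> and \<open>R = 2QQ\<^sup>T - I\<close> are involutive
  isometries, so \<open>U = SR\<close> has inverse \<open>RS\<close>, and \<open>Q\<^sup>T(U + U\<^sup>-\<^sup>1) = 2DQ\<^sup>T\<close> yields \<open>Q\<^sup>T U\<^sup>k Q = T\<^sub>k(D)\<close>.
  Hence \<open>T\<^sub>k(D)\<close> is a self-adjoint contraction whose \<open>(j, i)\<close> entry has absolute value 1. By the
  equality case of Cauchy--Schwarz it maps \<open>e\<^sub>i\<close> to \<open>c e\<^sub>j\<close> and \<open>e\<^sub>j\<close> to \<open>c e\<^sub>i\<close> with \<open>c\<^sup>2 = 1\<close>, so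
  \<open>T\<^sub>k(D)\<^sup>2\<close> fixes \<open>e\<^sub>i\<close>. An eigenvector for \<open>\<mu>\<close> not orthogonal to \<open>e\<^sub>i\<close> then forces \<open>T\<^sub>k(\<mu>)\<^sup>2 = 1\<close>.\<close>

section \<open>Chebyshev polynomials of a linear map\<close>

text \<open>This is \<open>T_k(f) x\<close>, with the Chebyshev recurrence run directly on vectors,
  so that no powers of \<open>f\<close> have to be formed.\<close>

fun chebyshev_op :: "('a::real_vector \<Rightarrow> 'a) \<Rightarrow> nat \<Rightarrow> 'a \<Rightarrow> 'a" where
  "chebyshev_op f 0 x = x"
| "chebyshev_op f (Suc 0) x = f x"
| "chebyshev_op f (Suc (Suc k)) x = 2 *\<^sub>R f (chebyshev_op f (Suc k) x) - chebyshev_op f k x"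

lemma chebyshev_op_eigenvector:
  assumes "linear f" "f v = \<mu> *\<^sub>R v"
  shows "chebyshev_op f k v = chebyshev_T k \<mu> *\<^sub>R v"
  using assms(2) by (induction k \<mu> rule: chebyshev_T.induct)
    (use assms(1) in \<open>auto simp: linear_scale algebra_simps\<close>)

lemma chebyshev_op_commute:
  assumes "linear f"
  shows "chebyshev_op f k (f x) = f (chebyshev_op f k x)"
  using assms by (induction f k x rule: chebyshev_op.induct) (auto simp: linear_scale linear_diff)

text \<open>Moving \<open>f\<close> and then \<open>T_k(f)\<close> across the inner product reverses
  their order, which is harmless because they commute. Two consecutive indices are carried, as the
  recurrence has order two.\<close>

lemma chebyshev_op_self_adjoint:
  fixes f :: "'a::real_inner \<Rightarrow> 'a"
  assumes "linear f" and f: "\<And>x y. f x \<bullet> y = x \<bullet> f y"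
  shows "chebyshev_op f k x \<bullet> y = x \<bullet> chebyshev_op f k y"
proof -
  have "chebyshev_op f k x \<bullet> y = x \<bullet> chebyshev_op f k y \<and>
    chebyshev_op f (Suc k) x \<bullet> y = x \<bullet> chebyshev_op f (Suc k) y" for x y
  proof (induction k arbitrary: x y)
    case (Suc k)
    have "f (chebyshev_op f (Suc k) x) \<bullet> y = x \<bullet> f (chebyshev_op f (Suc k) y)"
      using Suc by (metis f chebyshev_op_commute[OF \<open>linear f\<close>])
    with Suc show ?case by (simp add: inner_diff_left inner_diff_right)
  qed (simp add: f)
  then show ?thesis by blast
qed

section \<open>Unit vectors under a self-adjoint contraction\<close>

text \<open>With \<open>c = f u \<bullet> v\<close>, the squared norm of
  \<open>f u - c *\<^sub>R v\<close> is \<open>f u \<bullet> f u - c * c\<close>, which is at most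
  \<open>1 - 1\<close>.\<close>

lemma contraction_unit_vectors:
  fixes f :: "'a::real_inner \<Rightarrow> 'a"
  assumes "norm (f u) \<le> 1" "norm v = 1" "\<bar>f u \<bullet> v\<bar> = 1"
  shows "f u = (f u \<bullet> v) *\<^sub>R v"
proof -
  have vv: "v \<bullet> v = 1" using assms by (simp add: norm_eq_1)
  have c: "(f u \<bullet> v)\<^sup>2 = 1" using assms by (simp add: power2_eq_1_iff abs_if split: if_splits)
  have "f u \<bullet> f u \<le> 1"
    using assms by (metis power2_norm_eq_inner norm_ge_zero power_le_one)
  then have "(f u - (f u \<bullet> v) *\<^sub>R v) \<bullet> (f u - (f u \<bullet> v) *\<^sub>R v) \<le> 0"
    using c vv by (simp add: inner_diff_left inner_diff_right inner_commute power2_eq_square)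
  then show ?thesis by (metis inner_eq_zero_iff inner_ge_zero order_antisym right_minus_eq)
qed

text \<open>Self-adjointness gives \<open>f v \<bullet> u\<close> the same value \<open>c\<close> as
  \<open>f u \<bullet> v\<close>, so the equality case applies in both directions.\<close>

lemma self_adjoint_contraction_square_fixes:
  fixes f :: "'a::real_inner \<Rightarrow> 'a"
  assumes "linear f" "\<And>x y. f x \<bullet> y = x \<bullet> f y" "\<And>x. norm (f x) \<le> norm x"
    and "norm u = 1" "norm v = 1" "\<bar>f u \<bullet> v\<bar> = 1"
  shows "f (f u) = u"
proof -
  define c where "c = f u \<bullet> v"
  have c: "f v \<bullet> u = c" unfolding c_def using assms(2) by (simp add: inner_commute)
  have "f u = c *\<^sub>R v" unfolding c_def
    by (rule contraction_unit_vectors) (use assms(3)[of u] assms in auto)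
  moreover have "f v = c *\<^sub>R u"
    using contraction_unit_vectors[of f v u] assms(3)[of v] assms(4-6) c by (simp add: c_def)
  moreover have "c * c = 1"
    using assms(6) by (auto simp: c_def[symmetric] abs_if split: if_splits)
  ultimately show ?thesis using \<open>linear f\<close> by (simp add: linear_scale)
qed

section \<open>The real form of the walk\<close>

definition coin_matrix :: "('d::finite \<Rightarrow> real^'r^'r::finite) \<Rightarrow> real^('d \<times> 'r)^('d \<times> 'r)" where
  "coin_matrix P = 2 *\<^sub>R (terminal_matrix P ** transpose (terminal_matrix P)) - mat 1"

declare transpose_matrix_vector [simp del]

lemma inner_matrix_transpose:
  fixes A :: "real^'n::finite^'m::finite"
  shows "(A *v x) \<bullet> y = x \<bullet> (transpose A *v y)"
  by (metis dot_lmul_matrix inner_commute transpose_matrix_vector)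

lemma terminal_left_inverse:
  "transpose (terminal_matrix P) *v (terminal_matrix P *v x) = x"
  by (simp add: matrix_vector_mul_assoc terminal_matrix_orthonormal)

lemma norm_terminal: "norm (terminal_matrix P *v x) = norm x"
  by (simp add: norm_eq_sqrt_inner inner_matrix_transpose terminal_left_inverse)

text \<open>The adjoint of an isometry is a contraction, by Cauchy-Schwarz.\<close>

lemma norm_transpose_terminal_le: "norm (transpose (terminal_matrix P) *v y) \<le> norm y"
proof -
  let ?x = "transpose (terminal_matrix P) *v y"
  have "norm ?x * norm ?x = (terminal_matrix P *v ?x) \<bullet> y"
    by (simp add: inner_matrix_transpose flip: power2_norm_eq_inner power2_eq_square)
  also have "\<dots> \<le> norm ?x * norm y"
    using norm_cauchy_schwarz[of "terminal_matrix P *v ?x" y] by (simp add: norm_terminal)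
  finally show ?thesis
    by (cases "norm ?x = 0") (auto simp: mult_le_cancel_left)
qed

lemma coin_apply:
  "coin_matrix P *v x
     = 2 *\<^sub>R (terminal_matrix P *v (transpose (terminal_matrix P) *v x)) - x"
  by (simp add: coin_matrix_def matrix_vector_mult_diff_rdistrib matrix_vector_mul_assoc
      flip: scaleR_matrix_vector_assoc)

lemma coin_terminal: "coin_matrix P *v (terminal_matrix P *v x) = terminal_matrix P *v x"
  by (simp add: coin_apply terminal_left_inverse scaleR_2)

lemma transpose_terminal_coin:
  "transpose (terminal_matrix P) *v (coin_matrix P *v x) = transpose (terminal_matrix P) *v x"
  by (simp add: coin_apply matrix_vector_mult_diff_distrib matrix_vector_mult_scaleR
      terminal_left_inverse) (simp add: scaleR_2)

lemma norm_coin: "norm (coin_matrix P *v x) = norm x"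
proof -
  let ?y = "terminal_matrix P *v (transpose (terminal_matrix P) *v x)"
  \<comment> \<open>\<open>?y\<close> is the orthogonal projection of \<open>x\<close> onto the
    range of \<open>terminal_matrix P\<close>, so the cross terms in the squared norm of
    \<open>2 *\<^sub>R ?y - x\<close> cancel.\<close>
  have "?y \<bullet> ?y = x \<bullet> ?y"
    by (metis inner_commute inner_matrix_transpose terminal_left_inverse)
  then show ?thesis
    by (simp add: norm_eq_sqrt_inner coin_apply inner_diff_left inner_diff_right inner_commute)
qed

lemma shift_inner:
  fixes P :: "'d::finite \<Rightarrow> real^'r^'r::finite"
  assumes "shunt_decomposition A P"
  shows "(shift_matrix P *v x) \<bullet> (shift_matrix P *v y) = x \<bullet> y"
proof -
  have "\<forall>s. \<exists>\<sigma>. \<sigma> permutes UNIV \<and> P s = (\<chi> i j. if j = \<sigma> i then 1 else 0)"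
    using assms by (simp add: shunt_decomposition_def permutation_matrix_def)
  then obtain \<sigma> where \<sigma>: "\<And>s. \<sigma> s permutes UNIV"
    and P: "\<And>s. P s = (\<chi> i j. if j = \<sigma> s i then 1 else 0)" by metis
  \<comment> \<open>The permutations of the individual shunts combine into one permutation of the
    arcs, and \<open>shift_matrix P\<close> permutes coordinates by it.\<close>
  define g where "g = (\<lambda>(s, c). (s, \<sigma> s c))"
  have "bij g"
  proof (rule bijI)
    show "inj g" using \<sigma>
      by (auto simp: g_def inj_def dest: permutes_inj injD)
    show "surj g"
      by (rule surjI[where f = "\<lambda>(s, c). (s, inv (\<sigma> s) c)"])
        (auto simp: g_def permutes_inverses[OF \<sigma>])
  qed
  have entry: "shift_matrix P $ p $ q = (if q = g p then 1 else 0)" for p q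
  proof -
    have "shift_matrix P $ p $ q
        = (\<Sum>s\<in>UNIV. if s = fst p then (if q = g p then 1 else 0) else 0)"
      unfolding shift_matrix_def sum_component
      by (rule sum.cong)
        (auto simp: kronecker_def matrix_unit_def P g_def split_def prod_eq_iff)
    then show ?thesis by simp
  qed
  have shift_apply: "(shift_matrix P *v z) $ p = z $ g p" for z p
  proof -
    have "(shift_matrix P *v z) $ p = (\<Sum>q\<in>UNIV. if q = g p then z $ q else 0)"
      by (simp add: matrix_vector_mult_def entry if_distrib[of "\<lambda>a. a * _"] cong: if_cong)
    then show ?thesis by simp
  qed
  show ?thesis unfolding inner_vec_def shift_apply
    using \<open>bij g\<close> by (rule sum.reindex_bij_betw)
qed

section \<open>Symmetric shifts and the compression of the walk to the cells\<close>

context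
  fixes P :: "'d::finite \<Rightarrow> real^'r^'r::finite" and A :: "real^'r^'r"
  assumes shunt: "shunt_decomposition A P"
    and symm: "transpose (shift_matrix P) = shift_matrix P"
begin

text \<open>An orthogonal matrix that is symmetric is its own inverse.\<close>

lemma shift_involution: "shift_matrix P *v (shift_matrix P *v x) = x"
proof -
  have "(shift_matrix P *v (shift_matrix P *v x)) \<bullet> y = x \<bullet> y" for y
    using shift_inner[OF shunt, of x y] by (simp add: inner_matrix_transpose[of _ "_ *v _"] symm)
  then show ?thesis by (metis vector_eq_rdot)
qed

lemma norm_shift: "norm (shift_matrix P *v x) = norm x"
  by (simp add: norm_eq_sqrt_inner shift_inner[OF shunt])

lemma norm_walk: "norm (((\<lambda>z. shift_matrix P *v (coin_matrix P *v z)) ^^ k) x) = norm x"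
proof (induction k)
  case (Suc k)
  then show ?case by (simp add: norm_shift norm_coin)
qed simp

lemma discriminant_apply:
  "discriminant P *v x
     = transpose (terminal_matrix P) *v (shift_matrix P *v (terminal_matrix P *v x))"
  by (simp add: discriminant_def matrix_vector_mul_assoc matrix_mul_assoc)

lemma discriminant_self_adjoint: "(discriminant P *v x) \<bullet> y = x \<bullet> (discriminant P *v y)"
  by (simp add: discriminant_apply inner_matrix_transpose symm)

text \<open>Three consecutive compressed states satisfy the Chebyshev recurrence in
  \<open>discriminant P\<close>. The base case \<open>k = 1\<close> holds because the coin fixes the
  range of \<open>terminal_matrix P\<close>.\<close>

lemma compressed_walk_eq_chebyshev:
  "transpose (terminal_matrix P) *v
     ((\<lambda>z. shift_matrix P *v (coin_matrix P *v z)) ^^ k) (terminal_matrix P *v x)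
   = chebyshev_op (\<lambda>z. discriminant P *v z) k x"
proof (induction "\<lambda>z. discriminant P *v z" k x rule: chebyshev_op.induct)
  case (3 k x)
  let ?Q = "terminal_matrix P" and ?S = "shift_matrix P" and ?R = "coin_matrix P"
  define z where "z = ((\<lambda>z. ?S *v (?R *v z)) ^^ k) (?Q *v x)"
  define w where "w = ?S *v (?R *v z)"
  \<comment> \<open>The earlier state \<open>z\<close> is recovered from \<open>w\<close>: applying
    \<open>?S\<close> to \<open>w\<close> gives \<open>?R *v z\<close>, and
    \<open>transpose ?Q\<close> does not see \<open>?R\<close>.\<close>
  have "transpose ?Q *v z = transpose ?Q *v (?S *v w)"
    by (metis w_def shift_involution transpose_terminal_coin)
  \<comment> \<open>Expanding the coin at \<open>w\<close> produces the next state. The subtracted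
    term is the one just identified with the compression of \<open>z\<close>.\<close>
  moreover have "transpose ?Q *v (?S *v (?R *v w))
      = 2 *\<^sub>R (discriminant P *v (transpose ?Q *v w)) - transpose ?Q *v (?S *v w)"
    by (simp add: coin_apply discriminant_apply matrix_vector_mult_diff_distrib
        matrix_vector_mult_scaleR)
  ultimately show ?case using 3 by (simp add: z_def[symmetric] w_def[symmetric])
qed (simp_all add: terminal_left_inverse coin_terminal discriminant_apply)

end

section \<open>The complex walk\<close>

definition complex_vec :: "real^'n::finite \<Rightarrow> complex^'n" where
  "complex_vec x = (\<chi> a. complex_of_real (x $ a))"

lemma map_matrix_complex_vec:
  "map_matrix complex_of_real M *v complex_vec x = complex_vec (M *v x)"
  by (simp add: complex_vec_def map_matrix_def matrix_vector_mult_def vec_eq_iff)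

lemma vertex_state_complex_vec:
  "vertex_state P i = complex_vec (terminal_matrix P *v axis i 1)"
proof -
  \<comment> \<open>The left basis vector is complex, the right one is real.\<close>
  have "axis i 1 = complex_vec (axis i 1)"
    by (simp add: complex_vec_def axis_def vec_eq_iff)
  then show ?thesis by (simp add: vertex_state_def map_matrix_complex_vec)
qed

lemma evolution_complex_vec:
  "((\<lambda>z. evolution P *v z) ^^ k) (complex_vec x)
     = complex_vec (((\<lambda>z. shift_matrix P *v (coin_matrix P *v z)) ^^ k) x)"
  by (induction k)
    (simp_all add: evolution_def map_matrix_complex_vec matrix_vector_mul_assoc coin_matrix_def)

lemma hermitian_inner_complex_vec:
  "hermitian_inner (complex_vec x) (complex_vec y) = complex_of_real (x \<bullet> y)"
  by (simp add: hermitian_inner_def complex_vec_def inner_vec_def)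

text \<open>All data are real, and moving \<open>terminal_matrix P\<close> from the target state to
  the other side turns the amplitude into an entry of \<open>T_k\<close> of the
  discriminant.\<close>

lemma perfect_state_transfer_iff_chebyshev:
  assumes "shunt_decomposition A P" "transpose (shift_matrix P) = shift_matrix P"
  shows "perfect_state_transfer P i j k \<longleftrightarrow>
    \<bar>chebyshev_op (\<lambda>z. discriminant P *v z) k (axis i 1) \<bullet> axis j 1\<bar> = 1"
  by (simp add: perfect_state_transfer_def vertex_state_complex_vec evolution_complex_vec
      hermitian_inner_complex_vec inner_matrix_transpose compressed_walk_eq_chebyshev[OF assms]
      inner_commute[of "axis j 1"])

text \<open>By the compression formula this is an isometry, then \<open>k\<close> isometric walk
  steps, then a contraction. No bound on the spectrum is involved.\<close>

lemma norm_chebyshev_discriminant_le: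
  assumes "shunt_decomposition A P" "transpose (shift_matrix P) = shift_matrix P"
  shows "norm (chebyshev_op (\<lambda>z. discriminant P *v z) k x) \<le> norm x"
  unfolding compressed_walk_eq_chebyshev[OF assms, symmetric]
  using norm_transpose_terminal_le norm_walk[OF assms] norm_terminal by metis

section \<open>Eigenvectors witnessing the eigenvalue support\<close>

lemma subspace_eigenspace: "subspace (eigenspace M \<mu>)"
  by (auto simp: subspace_def eigenspace_def matrix_vector_right_distrib
      matrix_vector_mult_scaleR scaleR_right_distrib)

lemma eigenvalue_support_eigenvector:
  assumes "\<mu> \<in> eigenvalue_support M i"
  obtains v where "M *v v = \<mu> *\<^sub>R v" "v \<bullet> axis i 1 \<noteq> 0"
proof
  let ?v = "orthogonal_projection (eigenspace M \<mu>) (axis i 1)"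
  note p = orthogonal_projection_works[OF subspace_eigenspace, of M \<mu> "axis i 1"]
  then show "M *v ?v = \<mu> *\<^sub>R ?v" by (simp add: eigenspace_def)
  \<comment> \<open>The projection itself is the witness: its inner product with
    \<open>axis i 1\<close> equals its squared norm.\<close>
  have "(axis i 1 - ?v) \<bullet> ?v = 0" using p by (simp add: orthogonal_def)
  moreover have "?v \<noteq> 0" using assms by (simp add: eigenvalue_support_def)
  ultimately show "?v \<bullet> axis i 1 \<noteq> 0"
    by (metis inner_commute inner_diff_left inner_eq_zero_iff right_minus_eq)
qed

theorem theorem6p7:
  fixes G :: "('v, 'e) pre_digraph"
    and C :: "'r::finite \<Rightarrow> 'v set"
    and b :: "'r \<Rightarrow> 'r \<Rightarrow> nat"
    and P :: "'d::finite \<Rightarrow> real^'r^'r"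
    and i j :: 'r
    and k :: nat
  assumes "fin_digraph G" and "nomulti_digraph G"
    and "regular_digraph CARD('d) G"
    and "equitable_partition G C b"
    and "regular_adjacency CARD('d) (quotient_matrix b)"
    and "shunt_decomposition (quotient_matrix b) P"
    and "transpose (shift_matrix P) = shift_matrix P"
    and "perfect_state_transfer P i j k"
  shows "\<forall>\<mu> \<in> eigenvalue_support (discriminant P) i. chebyshev_T k \<mu> = 1 \<or> chebyshev_T k \<mu> = -1"
proof
  fix \<mu> assume "\<mu> \<in> eigenvalue_support (discriminant P) i"
  then obtain v where v: "discriminant P *v v = \<mu> *\<^sub>R v" "v \<bullet> axis i 1 \<noteq> 0"
    by (rule eigenvalue_support_eigenvector)
  define f where "f = chebyshev_op (\<lambda>z. discriminant P *v z) k"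
  have f_adj: "f x \<bullet> y = x \<bullet> f y" for x y
    unfolding f_def using discriminant_self_adjoint[OF assms(6,7)]
    by (intro chebyshev_op_self_adjoint) auto
  \<comment> \<open>A map with an adjoint is linear: testing against every vector moves
    \<open>f\<close> off the sum or multiple.\<close>
  have "linear f"
    by (rule linearI; rule vector_eq_rdot[THEN iffD1, rule_format])
      (simp_all add: f_adj inner_add_left)
  then have "f (f (axis i 1)) = axis i 1"
    using f_adj norm_chebyshev_discriminant_le[OF assms(6,7), of k]
      assms(8)[unfolded perfect_state_transfer_iff_chebyshev[OF assms(6,7)]]
    by (intro self_adjoint_contraction_square_fixes[where v = "axis j 1"])
      (auto simp: f_def)
  \<comment> \<open>Both copies of \<open>f\<close> move over to \<open>axis i 1\<close>, which
    \<open>f\<close> applied twice fixes.\<close>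
  then have "v \<bullet> axis i 1 = f (f v) \<bullet> axis i 1" by (simp add: f_adj)
  also have "f (f v) = (chebyshev_T k \<mu> * chebyshev_T k \<mu>) *\<^sub>R v"
    using chebyshev_op_eigenvector[of "\<lambda>z. discriminant P *v z", OF _ v(1)] \<open>linear f\<close>
    by (simp add: f_def linear_scale)
  finally have "chebyshev_T k \<mu> * chebyshev_T k \<mu> = 1" using v(2) by simp
  then show "chebyshev_T k \<mu> = 1 \<or> chebyshev_T k \<mu> = -1"
    by (simp add: square_eq_1_iff)
qed

end
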